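(* Let $q\neq0$ be a complex number. For complex $a,b$ and an integer $n$ define $$G_n(a,b):=\sum_{k=0}^{n-1}(1-a^2b^2q^{5k-2})\,\frac{(a,b;q)_k\,(a^2b^2/q^2;q^4)_k}{(ab^2q^2,a^2bq^2;q^4)_k\,(q;q)_k}\,\frac{(abq,ab/q,ab;q^3)_k}{(abq,ab,ab/q;q^2)_k}\,q^k ,$$ with $G_n(a,b)=0$ (empty sum) for $n\le 0$. Then for every integer $n\ge 0$, provided no denominator below (including those in the sums) vanishes, $$G_n(a,b)=G_{n-3}(aq^4,bq^4)\,\frac{ab(1-ab/q)q^4\,(aq,bq;q)_3\,(-ab/q;q^2)_4}{(1-abq^7)\,(ab^2q^2,a^2bq^2;q^4)_3}$$ $$+\frac{(aq,bq;q)_{n-1}\,(abq^2;q^4)_{n-1}\,(a^2b^2/q^2;q^4)_n}{(ab^2q^2,a^2bq^2;q^4)_{n-1}\,(abq,q;q)_{n-1}}\,\frac{(abq;q)_n\,(ab/q^2,ab/q,ab;q^3)_n}{(ab/q^2;q^4)_n\,(abq,ab,ab/q;q^2)_n}.$$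
   Context: For an integer $m\ge 0$, $(a;q)_m=\prod_{j=0}^{m-1}(1-aq^j)$, $(a;q)_{-1}=1/(1-a/q)$, and $(a_1,\dots,a_r;q)_m=\prod_{i=1}^r(a_i;q)_m$. For $n=0$ the factor $1/(q;q)_{-1}$ is read as $1-q/q=0$. *)

theory Defs
  imports Complex_Main
begin

text \<open>
  The \<open>q\<close>-shifted factorial \<open>(a;q)\<^sub>m\<close> for an integer index. For negative index the standard
  extension \<open>(a;q)\<^sub>-\<^sub>m = 1 / ((1 - a/q) \<cdots> (1 - a/q\<^sup>m))\<close> is used; only index \<open>-1\<close>, where it reads
  \<open>1 / (1 - a/q)\<close>, is needed. Because \<open>1 / 0 = 0\<close> in HOL, dividing by \<open>qpoch x q (-1)\<close> is the same as
  multiplying by \<open>1 - x/q\<close> for every \<open>x\<close>; in particular \<open>1 / qpoch q q (-1) = 1 - q/q = 0\<close>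
  when \<open>q\<close> is nonzero.
\<close>

definition qpoch :: "complex \<Rightarrow> complex \<Rightarrow> int \<Rightarrow> complex" where
  "qpoch a q m =
     (if m \<ge> 0 then (\<Prod>j<nat m. 1 - a * q ^ j)
      else 1 / (\<Prod>j=1..nat (- m). 1 - a / q ^ j))"

definition qpochs :: "complex list \<Rightarrow> complex \<Rightarrow> int \<Rightarrow> complex" where
  "qpochs as q m = (\<Prod>a\<leftarrow>as. qpoch a q m)"

definition G :: "complex \<Rightarrow> int \<Rightarrow> complex \<Rightarrow> complex \<Rightarrow> complex" where
  "G q n a b = (\<Sum>k<nat n.
     (1 - a^2 * b^2 * q powi (5 * int k - 2))
     * (qpochs [a, b] q (int k) * qpoch (a^2 * b^2 / q^2) (q^4) (int k)
        / (qpochs [a * b^2 * q^2, a^2 * b * q^2] (q^4) (int k) * qpoch q q (int k)))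
     * (qpochs [a * b * q, a * b / q, a * b] (q^3) (int k)
        / qpochs [a * b * q, a * b, a * b / q] (q^2) (int k))
     * q ^ k)"

text \<open>No denominator occurring in one of the summands of \<open>G q n a b\<close> vanishes.\<close>

definition G_defined :: "complex \<Rightarrow> int \<Rightarrow> complex \<Rightarrow> complex \<Rightarrow> bool" where
  "G_defined q n a b \<longleftrightarrow> (\<forall>k<nat n.
     qpochs [a * b^2 * q^2, a^2 * b * q^2] (q^4) (int k) * qpoch q q (int k) \<noteq> 0
     \<and> qpochs [a * b * q, a * b, a * b / q] (q^2) (int k) \<noteq> 0)"

end

theory Submission
  imports Defs
begin

text \<open>
  Write \<open>t\<^sub>k\<close> for the summand of \<open>G\<^sub>n(a,b)\<close>, \<open>t'\<^sub>k\<close> for the summand with \<open>a,b\<close> replaced by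
  \<open>aq\<^sup>4,bq\<^sup>4\<close>, \<open>C\<close> for the factor of \<open>G\<^sub>n\<^sub>-\<^sub>3\<close> and \<open>R\<^sub>n\<close> for the last term of the identity. The identity
  telescopes to \<open>t\<^sub>n = C t'\<^sub>n\<^sub>-\<^sub>3 + R\<^sub>n\<^sub>+\<^sub>1 - R\<^sub>n\<close>. The product \<open>C t'\<^sub>n\<^sub>-\<^sub>3\<close> can be rewritten with
  unshifted factorials; in this form it carries the factor
  \<open>(1 - q\<^sup>n)(1 - q\<^sup>n\<^sup>-\<^sup>1)(1 - q\<^sup>n\<^sup>-\<^sup>2)\<close> and so extends by zero to \<open>n = 1, 2\<close>. All four terms are
  rational multiples of one common product, and dividing it out leaves a polynomial identity in
  \<open>a + b\<close>, \<open>y = ab/q\<^sup>2\<close>, \<open>q\<close> and \<open>Q = q\<^sup>n\<close>. Using \<open>y\<close> as a parameter removes all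
  negative powers of \<open>q\<close>.
\<close>

section \<open>Shifted factorials with natural index\<close>

definition poch :: "complex \<Rightarrow> complex \<Rightarrow> nat \<Rightarrow> complex" where
  "poch a q n = (\<Prod>j<n. 1 - a * q ^ j)"

lemma poch_0 [simp]: "poch a q 0 = 1"
  by (simp add: poch_def)

lemma poch_Suc: "poch a q (Suc n) = poch a q n * (1 - a * q ^ n)"
  by (simp add: poch_def)

lemma poch_add: "poch a q (m + n) = poch a q m * poch (a * q ^ m) q n"
  by (induction n) (simp_all add: poch_Suc power_add mult.assoc)

lemma poch_Suc_left: "poch a q (Suc n) = (1 - a) * poch (a * q) q n"
  using poch_add[of a q 1 n] by (simp add: poch_def)

text \<open>Factor by factor a difference of squares; it serves to merge
  \<open>(-ab/q;q^2)_4\<close> with \<open>(ab/q;q^2)_4\<close>.\<close>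

lemma poch_mult_minus: "poch a q n * poch (- a) q n = poch (a\<^sup>2) (q\<^sup>2) n"
  by (induction n) (simp_all add: poch_Suc power2_eq_square power_mult_distrib algebra_simps)

lemma qpoch_int [simp]: "qpoch a q (int n) = poch a q n"
  by (simp add: qpoch_def poch_def)

lemma qpochs_simps [simp]:
  "qpochs [] q m = 1" "qpochs (a # as) q m = qpoch a q m * qpochs as q m"
  by (simp_all add: qpochs_def)

text \<open>With \<open>s\<close> = a + b the four products come, in order, from \<open>t_n\<close>,
  \<open>R_n\<close>, \<open>R_(n+1)\<close> and \<open>C t'_(n-3)\<close>, cleared of
  denominators.\<close>

lemma telescoping_polynomial_identity:
  fixes q y s Q :: complex
  shows "Q * (1 - s + q^2*y) * (1 - q^2*y^2*Q^5) * (1 - y*Q^3) * (1 - q^3*y*Q^2) * (1 - q^2*y*Q^2) * (1 - q*y*Q^2)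
     + (1 - q^2*y*Q) * (1 - s*y*Q^4 + q^2*y^3*Q^8) * (1 - Q) * (1 - q^3*y*Q^2) * (1 - q^2*y*Q^2) * (1 - q*y*Q^2)
     = (1 - s*Q + q^2*y*Q^2) * (1 - q^2*y^2*Q^4) * (1 - q^3*y*Q) * (1 - y*Q^3) * (1 - q*y*Q^3) * (1 - q^2*y*Q^3)
     + y*Q*(1 - s*Q + q^2*y*Q^2) * (1 - q^2*y^2*Q^4) * (1 - q^3*y^2*Q^5) * (1 - Q) * (q - Q) * (q^2 - Q)"
  by algebra

text \<open>\<open>y\<close> is a separate argument, tied to a and b only by hypotheses
  \<open>a * b = q^2 * y\<close>; passing to aq^4, bq^4 turns it into
  \<open>q^8 * y\<close>.\<close>

definition summand :: "complex \<Rightarrow> complex \<Rightarrow> complex \<Rightarrow> complex \<Rightarrow> nat \<Rightarrow> complex" where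
  "summand q a b y k = (1 - q^2 * y^2 * q ^ (5 * k))
     * (poch a q k * poch b q k * poch (q^2 * y^2) (q^4) k
        / (poch (b * y * q^4) (q^4) k * poch (a * y * q^4) (q^4) k * poch q q k))
     * (poch (q^3 * y) (q^3) k * poch (q * y) (q^3) k * poch (q^2 * y) (q^3) k
        / (poch (q^3 * y) (q^2) k * poch (q^2 * y) (q^2) k * poch (q * y) (q^2) k))
     * q ^ k"

lemma parameter_eqs:
  fixes q a b y :: complex
  assumes "q \<noteq> 0" and "a * b = q^2 * y"
  shows "a * b^2 * q^2 = b * y * q^4" "a^2 * b * q^2 = a * y * q^4" "a * b * q = q^3 * y"
    "a * b / q = q * y" "a * b / q^2 = y" "a^2 * b^2 / q^2 = q^2 * y^2" "a * b * q^2 = y * q^4"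
    "a * b * q^7 = y * q^9"
proof -
  show "a * b^2 * q^2 = b * y * q^4" "a^2 * b * q^2 = a * y * q^4" "a * b * q = q^3 * y"
    "a * b * q^2 = y * q^4" "a * b * q^7 = y * q^9"
    using assms(2) by algebra+
  show "a * b / q = q * y" "a * b / q^2 = y" "a^2 * b^2 / q^2 = q^2 * y^2"
    using assms by (simp_all add: power_mult_distrib[symmetric])
      (simp_all add: power_mult_distrib power2_eq_square)
qed

lemma G_eq_sum_summand:
  assumes q: "q \<noteq> 0" and y: "a * b = q^2 * y"
  shows "G q (int n) a b = (\<Sum>k<n. summand q a b y k)"
proof -
  have "a^2 * b^2 * q powi (5 * int k - 2) = q^2 * y^2 * q ^ (5 * k)" for k
  proof -
    \<comment> \<open>The exponent is negative at k = 0, so the power is split into a quotient of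
      natural powers.\<close>
    have "q powi (5 * int k - 2) = q powi int (5 * k) / q powi int 2"
      using q by (subst power_int_diff[symmetric]) simp_all
    then have "q powi (5 * int k - 2) = q ^ (5 * k) / q^2"
      by (simp only: power_int_of_nat)
    then show ?thesis
      unfolding parameter_eqs(6)[OF q y, symmetric] by simp
  qed
  then show ?thesis
    unfolding G_def summand_def parameter_eqs[OF q y] unfolding y
    by (simp add: mult.assoc)
qed

section \<open>The telescoping step\<close>

text \<open>With \<open>n = m + 1\<close>, this is \<open>R\<^sub>n / (1 - abq\<^sup>n)\<close>.\<close>

definition core :: "complex \<Rightarrow> complex \<Rightarrow> complex \<Rightarrow> complex \<Rightarrow> nat \<Rightarrow> complex" where
  "core q a b y m =
     poch (a * q) q m * poch (b * q) q m * poch (q^2 * y^2) (q^4) (Suc m)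
     * (poch (q^3 * y) (q^3) m * poch (q * y) (q^3) (Suc m) * poch (q^2 * y) (q^3) (Suc m))
     / (poch (b * y * q^4) (q^4) m * poch (a * y * q^4) (q^4) m * poch q q m
        * (poch (q^3 * y) (q^2) (Suc m) * poch (q^2 * y) (q^2) (Suc m) * poch (q * y) (q^2) (Suc m)))"

lemma last_factor_eqs:
  fixes q y c :: complex
  assumes "Q = q ^ Suc m"
  shows "q ^ Suc m = Q" "q * q ^ m = Q" "c * q * q ^ m = c * Q"
    "c * q^4 * (q^4)^m = c * Q^4" "q^3 * y * (q^3)^m = y * Q^3"
    "c * (q^2)^Suc m = c * Q^2" "c * (q^3)^Suc m = c * Q^3" "c * (q^4)^Suc m = c * Q^4"
    "q ^ (5 * Suc m) = Q^5"
  using assms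
  by (simp_all add: power_mult_distrib power_mult[symmetric] mult.commute)
    (simp_all add: power_add power_mult mult.commute)

text \<open>Splitting 1 - a and 1 - b off on the left and the other factors on the right leaves
  \<open>core\<close>.\<close>

lemma summand_eq_core:
  assumes Q: "Q = q ^ Suc m"
  shows "summand q a b y (Suc m)
    = core q a b y m * ((1 - a) * (1 - b) * Q * (1 - q^2 * y^2 * Q^5) * (1 - y * Q^3))
      / ((1 - b * y * Q^4) * (1 - a * y * Q^4) * (1 - Q))"
  unfolding summand_def core_def poch_Suc_left[of a] poch_Suc_left[of b]
    poch_Suc[of q q] poch_Suc[of "b * y * q^4"] poch_Suc[of "a * y * q^4"] poch_Suc[of "q^3 * y" "q^3"]
    last_factor_eqs[OF Q]
  by (simp add: ac_simps)

lemma core_Suc: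
  assumes Q: "Q = q ^ Suc m"
  shows "core q a b y (Suc m)
    = core q a b y m * ((1 - a * Q) * (1 - b * Q) * (1 - q^2 * y^2 * Q^4)
          * (1 - y * Q^3) * (1 - q * y * Q^3) * (1 - q^2 * y * Q^3))
      / ((1 - b * y * Q^4) * (1 - a * y * Q^4) * (1 - Q)
          * (1 - q^3 * y * Q^2) * (1 - q^2 * y * Q^2) * (1 - q * y * Q^2))"
  unfolding core_def poch_Suc[of _ _ "Suc m"]
    poch_Suc[of "a * q" q m] poch_Suc[of "b * q" q m]
    poch_Suc[of q q m] poch_Suc[of "b * y * q^4" _ m] poch_Suc[of "a * y * q^4" _ m] poch_Suc[of "q^3 * y" "q^3" m]
    last_factor_eqs[OF Q]
  by (simp add: ac_simps)

definition prefactor :: "complex \<Rightarrow> complex \<Rightarrow> complex \<Rightarrow> complex \<Rightarrow> complex" where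
  "prefactor q a b y = q^2 * y * (1 - q * y) * q^4 * (poch (a * q) q 3 * poch (b * q) q 3) * poch (- (q * y)) (q^2) 4
     / ((1 - y * q^9) * (poch (b * y * q^4) (q^4) 3 * poch (a * y * q^4) (q^4) 3))"

text \<open>With \<open>n = m + 1\<close>, this is \<open>C t'\<^sub>n\<^sub>-\<^sub>3\<close> for \<open>n \<ge> 3\<close>.\<close>

definition shifted :: "complex \<Rightarrow> complex \<Rightarrow> complex \<Rightarrow> complex \<Rightarrow> nat \<Rightarrow> complex" where
  "shifted q a b y m = (let Q = q ^ Suc m in
     core q a b y m * (y * Q * (1 - a * Q) * (1 - b * Q) * (1 - q^2 * y^2 * Q^4) * (1 - q^3 * y^2 * Q^5)
          * (1 - Q) * (q - Q) * (q^2 - Q))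
      / ((1 - b * y * Q^4) * (1 - a * y * Q^4) * (1 - Q)
          * (1 - q^3 * y * Q^2) * (1 - q^2 * y * Q^2) * (1 - q * y * Q^2)))"

text \<open>At n = 1 and n = 2 the factor \<open>q - Q\<close> or \<open>q^2 - Q\<close> is zero,
  matching the empty sum at n - 3.\<close>

lemma shifted_0: "shifted q a b y 0 = 0" and shifted_1: "shifted q a b y (Suc 0) = 0"
  by (simp_all add: shifted_def Let_def power2_eq_square)

lemma summand_telescopes:
  assumes y: "a * b = q^2 * y" and Q: "Q = q ^ Suc m"
    and "1 - b * y * Q^4 \<noteq> 0" "1 - a * y * Q^4 \<noteq> 0" "1 - Q \<noteq> 0"
      "1 - q^3 * y * Q^2 \<noteq> 0" "1 - q^2 * y * Q^2 \<noteq> 0" "1 - q * y * Q^2 \<noteq> 0"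
  shows "summand q a b y (Suc m)
    = shifted q a b y m + core q a b y (Suc m) * (1 - q^3 * y * Q) - core q a b y m * (1 - q^2 * y * Q)"
proof -
  define A B C where "A = (1 - b * y * Q^4) * (1 - a * y * Q^4)" and "B = 1 - Q"
    and "C = (1 - q^3 * y * Q^2) * (1 - q^2 * y * Q^2) * (1 - q * y * Q^2)"
  have nz: "A \<noteq> 0" "B \<noteq> 0" "C \<noteq> 0"
    using assms by (simp_all add: A_def B_def C_def)
  define S T U where "S = (1 - a) * (1 - b) * Q * (1 - q^2 * y^2 * Q^5) * (1 - y * Q^3)"
    and "T = y * Q * (1 - a * Q) * (1 - b * Q) * (1 - q^2 * y^2 * Q^4) * (1 - q^3 * y^2 * Q^5)
          * (1 - Q) * (q - Q) * (q^2 - Q)"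
    and "U = (1 - a * Q) * (1 - b * Q) * (1 - q^2 * y^2 * Q^4)
          * (1 - y * Q^3) * (1 - q * y * Q^3) * (1 - q^2 * y * Q^3)"
  \<comment> \<open>By symmetry a and b enter only through a + b and ab, so the polynomial identity
    applies.\<close>
  have prods: "(1 - a) * (1 - b) = 1 - (a + b) + q^2 * y"
    "(1 - a * Q) * (1 - b * Q) = 1 - (a + b) * Q + q^2 * y * Q^2"
    "A = 1 - (a + b) * y * Q^4 + q^2 * y^3 * Q^8"
    unfolding A_def using y by algebra+
  have key: "S * C + (1 - q^2 * y * Q) * A * B * C = U * (1 - q^3 * y * Q) + T"
    using telescoping_polynomial_identity[of Q "a + b" q y]
    unfolding S_def T_def U_def B_def C_def prods[symmetric]
    by (simp only: ac_simps)
  have "summand q a b y (Suc m) = core q a b y m * S / (A * B)"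
    unfolding summand_eq_core[OF Q] S_def A_def B_def by simp
  also have "\<dots> = core q a b y m * (S * C) / (A * B * C)"
    using nz by simp
  also have "S * C = U * (1 - q^3 * y * Q) + T - (1 - q^2 * y * Q) * (A * B * C)"
    using key by (simp add: algebra_simps)
  also have "core q a b y m * \<dots> / (A * B * C)
      = core q a b y m * T / (A * B * C) + core q a b y m * U / (A * B * C) * (1 - q^3 * y * Q)
        - core q a b y m * (1 - q^2 * y * Q)"
    using nz by (simp add: field_simps)
  also have "core q a b y m * T / (A * B * C) = shifted q a b y m"
    unfolding shifted_def Let_def Q[symmetric] T_def A_def B_def C_def by (simp only: mult.assoc)
  also have "core q a b y m * U / (A * B * C) = core q a b y (Suc m)"
    unfolding core_Suc[OF Q] U_def A_def B_def C_def by (simp only: mult.assoc)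
  finally show ?thesis .
qed

section \<open>Rewriting \<open>C t'_k\<close> with unshifted factorials\<close>

lemma poch_numerals:
  "poch a q 2 = (1 - a) * (1 - a * q)"
  "poch a q 3 = (1 - a) * (1 - a * q) * (1 - a * q^2)"
  "poch a q 4 = (1 - a) * (1 - a * q) * (1 - a * q^2) * (1 - a * q^3)"
  by (simp_all add: poch_def eval_nat_numeral)

text \<open>
  Isolates the cancellation in \<open>C t'\<^sub>k\<close>: \<open>K1\<close> collects the first eight factors of
  \<open>(ab/q;q)\<^sub>\<infinity>\<close>, which are also \<open>T = (ab/q;q\<^sup>2)\<^sub>4\<close> times \<open>X = (ab;q\<^sup>2)\<^sub>4\<close>, while
  \<open>L = (abq;q\<^sup>2)\<^sub>4\<close> and \<open>M = (-ab/q;q\<^sup>2)\<^sub>4\<close>.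
\<close>

lemma cancel_split_products:
  fixes K1 :: "'a::field"
  assumes "K1 = T * X" and "v * L = T * w" and "w \<noteq> 0" "T \<noteq> 0" "X \<noteq> 0" "L \<noteq> 0" "r \<noteq> 0"
  shows "c * v * d * P1 * M / (w * D1) * (e * (P2 * W2 / (D2 * g)) * (K2 / L2) * h)
    = c * d * e * h * r * (P1 * P2) * (T * M * W2) * (K1 * K2) / (D1 * D2 * (g * r) * (L * X * T * L2))"
proof -
  have v: "v = T * w / L"
    using assms by (simp add: field_simps)
  show ?thesis
    unfolding v assms(1) using assms(3-) by (simp add: ac_simps)
qed

lemma shifted_eq:
  assumes Q: "Q = q ^ Suc m"
  shows "shifted q a b y m =
    y * Q * (1 - q^3 * y^2 * Q^5) * ((1 - Q) * (q - Q) * (q^2 - Q))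
      * (poch (a * q) q (Suc m) * poch (b * q) q (Suc m)) * poch (q^2 * y^2) (q^4) (Suc (Suc m))
      * (poch (q^3 * y) (q^3) m * poch (q * y) (q^3) (Suc m) * poch (q^2 * y) (q^3) (Suc m))
      / ((poch (b * y * q^4) (q^4) (Suc m) * poch (a * y * q^4) (q^4) (Suc m)) * poch q q (Suc m)
        * (poch (q^3 * y) (q^2) (Suc (Suc m)) * poch (q^2 * y) (q^2) (Suc (Suc m)) * poch (q * y) (q^2) (Suc (Suc m))))"
  unfolding shifted_def Let_def core_def poch_Suc[of _ _ "Suc m"]
    poch_Suc[of "a * q" q m] poch_Suc[of "b * q" q m]
    poch_Suc[of q q m] poch_Suc[of "b * y * q^4" _ m] poch_Suc[of "a * y * q^4" _ m]
    last_factor_eqs[OF Q]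
  by (simp add: ac_simps)

text \<open>Up to cancelling factors, C supplies the heads and the shifted summand the tails in
  \<open>(c;s)_j (c s^j;s)_k = (c;s)_(j+k)\<close>.\<close>

lemma prefactor_times_summand:
  assumes nz: "poch q q (k + 3) \<noteq> 0" "poch (q^3 * y) (q^2) (k + 4) \<noteq> 0"
      "poch (q^2 * y) (q^2) (k + 4) \<noteq> 0" "poch (q * y) (q^2) (k + 4) \<noteq> 0"
  shows "prefactor q a b y * summand q (a * q^4) (b * q^4) (q^8 * y) k = shifted q a b y (k + 2)"
proof -
  define p Q where "p = q ^ k" and "Q = q ^ Suc (k + 2)"
  have Qp: "Q = q^3 * p"
    by (simp add: p_def Q_def power_add eval_nat_numeral)
  have p5: "q ^ (5 * k) = p^5"
    by (simp add: p_def power_mult[symmetric] mult.commute)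
  \<comment> \<open>The last three factors of \<open>(q;q)_(k+3)\<close>; up to powers of q they are
    \<open>q^2 - Q\<close>, \<open>q - Q\<close> and \<open>1 - Q\<close>.\<close>
  define r where "r = (1 - q * p) * (1 - q^2 * p) * (1 - q^3 * p)"
  define T X L K where "T = poch (q * y) (q^2) 4" and "X = poch (q^2 * y) (q^2) 4"
    and "L = poch (q^3 * y) (q^2) 4"
    and "K = poch (q^3 * y) (q^3) 2 * poch (q * y) (q^3) 3 * poch (q^2 * y) (q^3) 3"
  have split: "poch c s (k + 3) = poch c s 3 * poch (c * s^3) s k"
    "poch c s (k + 4) = poch c s 4 * poch (c * s^4) s k"
    "poch c s (k + 2) = poch c s 2 * poch (c * s^2) s k" for c s
    by (simp_all add: poch_add[symmetric] add.commute)
  have r: "poch q q (k + 3) = poch q q k * r"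
    by (simp add: poch_Suc numeral_3_eq_3 r_def p_def power2_eq_square mult.assoc)
  have nz': "r \<noteq> 0" "T \<noteq> 0" "X \<noteq> 0" "L \<noteq> 0"
    using nz unfolding r T_def X_def L_def by (simp_all add: split)
  have "1 - y * q^9 \<noteq> 0"
    using nz'(4) by (simp add: L_def poch_numerals power_mult[symmetric] power_add[symmetric] mult_ac)
  have K: "K = T * X"
    unfolding K_def T_def X_def poch_numerals by algebra
  \<comment> \<open>\<open>L\<close> is \<open>T\<close> moved to the next odd powers of q, so only
    the end factors differ.\<close>
  have TL: "(1 - q * y) * L = T * (1 - y * q^9)"
    unfolding T_def L_def poch_numerals by algebra
  \<comment> \<open>Multiplying y by q^8 permutes the residues of the exponents mod 3, hence the
    lengths 2, 3, 3 in \<open>K\<close>.\<close>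
  have args: "a * q * q^3 = a * q^4" "b * q * q^3 = b * q^4"
    "b * y * q^4 * (q^4)^3 = (b * q^4) * (q^8 * y) * q^4"
    "a * y * q^4 * (q^4)^3 = (a * q^4) * (q^8 * y) * q^4"
    "q^2 * y^2 * (q^4)^4 = q^2 * (q^8 * y)^2"
    "q^3 * y * (q^3)^2 = q * (q^8 * y)" "q * y * (q^3)^3 = q^2 * (q^8 * y)" "q^2 * y * (q^3)^3 = q^3 * (q^8 * y)"
    "q^3 * y * (q^2)^4 = q^3 * (q^8 * y)" "q^2 * y * (q^2)^4 = q^2 * (q^8 * y)" "q * y * (q^2)^4 = q * (q^8 * y)"
    by algebra+
  have M: "T * poch (- (q * y)) (q^2) 4 = poch (q^2 * y^2) (q^4) 4"
    unfolding T_def poch_mult_minus by (simp add: power_mult_distrib power_mult[symmetric])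
  have num: "q^2 * y * q^4 * (1 - q^2 * (q^8 * y)^2 * p^5) * p * r
    = y * Q * (1 - q^3 * y^2 * Q^5) * ((1 - Q) * (q - Q) * (q^2 - Q))"
    unfolding r_def Qp by algebra
  have idx: "Suc (k + 2) = k + 3" "Suc (k + 3) = k + 4" by simp_all
  show ?thesis
    unfolding prefactor_def summand_def p5 p_def[symmetric]
      cancel_split_products[OF K TL \<open>1 - y * q^9 \<noteq> 0\<close> nz'(2,3,4,1)]
      num M shifted_eq[OF Q_def] idx r
    unfolding split args K_def T_def X_def L_def
    by (simp add: ac_simps)
qed

section \<open>Summation and the boundary term\<close>

lemma sum_summand:
  assumes y: "a * b = q^2 * y"
    and "poch (b * y * q^4) (q^4) m \<noteq> 0" "poch (a * y * q^4) (q^4) m \<noteq> 0" "poch q q m \<noteq> 0"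
      "poch (q^3 * y) (q^2) (Suc m) \<noteq> 0" "poch (q^2 * y) (q^2) (Suc m) \<noteq> 0"
      "poch (q * y) (q^2) (Suc m) \<noteq> 0"
  shows "(\<Sum>k<Suc m. summand q a b y k)
    = prefactor q a b y * (\<Sum>k<m - 2. summand q (a * q^4) (b * q^4) (q^8 * y) k)
      + core q a b y m * (1 - q^2 * y * q ^ Suc m)"
  using assms(2-)
proof (induction m)
  \<comment> \<open>Here n = 1, and both sides reduce to \<open>1 - q^2 * y^2\<close>.\<close>
  case 0
  then show ?case
    by (simp add: summand_def core_def poch_Suc power3_eq_cube power2_eq_square mult_ac)
next
  case (Suc m)
  define Q where "Q = q ^ Suc m"
  have prev: "(\<Sum>k<Suc m. summand q a b y k)
    = prefactor q a b y * (\<Sum>k<m - 2. summand q (a * q^4) (b * q^4) (q^8 * y) k)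
      + core q a b y m * (1 - q^2 * y * Q)"
    unfolding Q_def
    by (rule Suc.IH) (use Suc.prems in \<open>simp_all add: poch_Suc\<close>)
  have step: "summand q a b y (Suc m)
    = shifted q a b y m + core q a b y (Suc m) * (1 - q^3 * y * Q) - core q a b y m * (1 - q^2 * y * Q)"
    using Suc.prems unfolding poch_Suc[of _ _ "Suc m"] poch_Suc[of q q m] 
       poch_Suc[of "b * y * q^4" _ m] poch_Suc[of "a * y * q^4" _ m] last_factor_eqs[OF Q_def]
    by (intro summand_telescopes y Q_def) (simp_all add: ac_simps)
  \<comment> \<open>For m < 2 truncated subtraction makes both sums empty, and
    \<open>shifted\<close> is zero.\<close>
  have shift: "prefactor q a b y * (\<Sum>k<Suc m - 2. summand q (a * q^4) (b * q^4) (q^8 * y) k)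
    = prefactor q a b y * (\<Sum>k<m - 2. summand q (a * q^4) (b * q^4) (q^8 * y) k) + shifted q a b y m"
  proof (cases "m < 2")
    case True
    then have "m = 0 \<or> m = Suc 0" by auto
    then show ?thesis by (auto simp: shifted_0 shifted_1)
  next
    case False
    then obtain k where k: "m = k + 2" by (metis add.commute le_Suc_ex not_less)
    have "prefactor q a b y * summand q (a * q^4) (b * q^4) (q^8 * y) k = shifted q a b y m"
      unfolding k using Suc.prems unfolding k
      by (intro prefactor_times_summand) (simp_all add: eval_nat_numeral)
    then show ?thesis by (simp add: k distrib_left)
  qed
  have "(\<Sum>k<Suc (Suc m). summand q a b y k) = (\<Sum>k<Suc m. summand q a b y k) + summand q a b y (Suc m)"
    by simp
  also have "\<dots> = prefactor q a b y * (\<Sum>k<Suc m - 2. summand q (a * q^4) (b * q^4) (q^8 * y) k)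
      + core q a b y (Suc m) * (1 - q^3 * y * Q)"
    unfolding prev step shift by simp
  also have "q^3 * y * Q = q^2 * y * q ^ Suc (Suc m)"
    by (simp add: Q_def power2_eq_square power3_eq_cube)
  finally show ?case .
qed

text \<open>The left side is \<open>R_n\<close> at n = m + 1: the first factor 1 - y cancels between
  the bases q^3 and q^4, and \<open>(abq;q)_n / (abq;q)_(n-1)\<close> leaves 1 - abq^n.\<close>

lemma boundary_eq_core:
  assumes "poch y (q^4) (Suc m) \<noteq> 0" "poch (q^3 * y) q m \<noteq> 0"
  shows "poch (a * q) q m * poch (b * q) q m * poch (y * q^4) (q^4) m * poch (q^2 * y^2) (q^4) (Suc m)
      / (poch (b * y * q^4) (q^4) m * poch (a * y * q^4) (q^4) m * (poch (q^3 * y) q m * poch q q m))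
      * (poch (q^3 * y) q (Suc m) * (poch y (q^3) (Suc m) * poch (q * y) (q^3) (Suc m) * poch (q^2 * y) (q^3) (Suc m))
        / (poch y (q^4) (Suc m)
          * (poch (q^3 * y) (q^2) (Suc m) * poch (q^2 * y) (q^2) (Suc m) * poch (q * y) (q^2) (Suc m))))
    = core q a b y m * (1 - q^2 * y * q ^ Suc m)"
proof -
  have "poch (q^3 * y) q (Suc m) = poch (q^3 * y) q m * (1 - q^2 * y * q ^ Suc m)"
    by (simp add: poch_Suc power2_eq_square power3_eq_cube mult_ac)
  moreover have "poch y (q^3) (Suc m) = (1 - y) * poch (q^3 * y) (q^3) m"
    by (simp add: poch_Suc_left mult.commute)
  moreover have "poch y (q^4) (Suc m) = (1 - y) * poch (y * q^4) (q^4) m"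
    by (simp add: poch_Suc_left)
  moreover have "1 - y \<noteq> 0" "poch (y * q^4) (q^4) m \<noteq> 0"
    using assms(1) by (simp_all add: poch_Suc_left)
  ultimately show ?thesis
    using assms(2) unfolding core_def by (simp add: ac_simps)
qed

theorem theorem3p16:
  fixes q a b :: complex and n :: int
  assumes "q \<noteq> 0" and "n \<ge> 0"
    and "G_defined q n a b"
    and "G_defined q (n - 3) (a * q^4) (b * q^4)"
    and "(1 - a * b * q^7) * qpochs [a * b^2 * q^2, a^2 * b * q^2] (q^4) 3 \<noteq> 0"
    and "n \<ge> 1 \<Longrightarrow>
           qpochs [a * b^2 * q^2, a^2 * b * q^2] (q^4) (n - 1) * qpochs [a * b * q, q] q (n - 1) \<noteq> 0"
    and "qpoch (a * b / q^2) (q^4) n * qpochs [a * b * q, a * b, a * b / q] (q^2) n \<noteq> 0"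
  shows "G q n a b =
      G q (n - 3) (a * q^4) (b * q^4)
        * (a * b * (1 - a * b / q) * q^4 * qpochs [a * q, b * q] q 3 * qpoch (- (a * b / q)) (q^2) 4
           / ((1 - a * b * q^7) * qpochs [a * b^2 * q^2, a^2 * b * q^2] (q^4) 3))
      + (qpochs [a * q, b * q] q (n - 1) * qpoch (a * b * q^2) (q^4) (n - 1)
           * qpoch (a^2 * b^2 / q^2) (q^4) n
         / (qpochs [a * b^2 * q^2, a^2 * b * q^2] (q^4) (n - 1) * qpochs [a * b * q, q] q (n - 1)))
        * (qpoch (a * b * q) q n * qpochs [a * b / q^2, a * b / q, a * b] (q^3) n
           / (qpoch (a * b / q^2) (q^4) n * qpochs [a * b * q, a * b, a * b / q] (q^2) n))"
proof -
  define y where "y = a * b / q^2"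
  have y: "a * b = q^2 * y"
    using \<open>q \<noteq> 0\<close> by (simp add: y_def)
  then have y': "a * q^4 * (b * q^4) = q^2 * (q^8 * y)"
    by algebra
  note pars = parameter_eqs[OF \<open>q \<noteq> 0\<close> y]
  show ?thesis
  proof (cases "n = 0")
    case True
    \<comment> \<open>This value comes from 1/0 = 0; dividing by it annihilates the last term, as
      the convention for \<open>1/(q;q)_(-1)\<close> demands.\<close>
    have "qpoch q q (- 1) = 0"
      using \<open>q \<noteq> 0\<close> by (simp add: qpoch_def)
    with True show ?thesis
      by (simp add: G_def)
  next
    case False
    then obtain m where n: "n = int (Suc m)"
      using \<open>n \<ge> 0\<close> by (metis nonneg_int_cases not0_implies_Suc of_nat_0)
    have n1: "n - 1 = int m" by (simp add: n)
    have G': "G q (n - 3) (a * q^4) (b * q^4) = (\<Sum>k<m - 2. summand q (a * q^4) (b * q^4) (q^8 * y) k)"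
    \<comment> \<open>For n = 1, 2 the index n - 3 is negative; \<open>nat\<close> sends it to 0, as
      truncation does with \<open>m - 2\<close>.\<close>
    proof (cases "m < 2")
      case True
      then show ?thesis by (simp add: G_def n)
    next
      case False
      then have "n - 3 = int (m - 2)" by (simp add: n)
      then show ?thesis by (simp only: G_eq_sum_summand[OF \<open>q \<noteq> 0\<close> y'])
    qed
    have nz: "poch (b * y * q^4) (q^4) m \<noteq> 0" "poch (a * y * q^4) (q^4) m \<noteq> 0" "poch q q m \<noteq> 0"
      "poch (q^3 * y) q m \<noteq> 0"
      using assms(6) unfolding n1 pars by (simp_all add: n)
    have nz': "poch y (q^4) (Suc m) \<noteq> 0"
      "poch (q^3 * y) (q^2) (Suc m) \<noteq> 0" "poch (q^2 * y) (q^2) (Suc m) \<noteq> 0" "poch (q * y) (q^2) (Suc m) \<noteq> 0"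
      using assms(7) unfolding n pars unfolding y by (simp_all del: of_nat_Suc)
    have three: "qpoch c s 3 = poch c s 3" and four: "qpoch c s 4 = poch c s 4" for c s
      using qpoch_int[of c s 3] qpoch_int[of c s 4] by simp_all
    have pre: "a * b * (1 - a * b / q) * q^4 * qpochs [a * q, b * q] q 3 * qpoch (- (a * b / q)) (q^2) 4
           / ((1 - a * b * q^7) * qpochs [a * b^2 * q^2, a^2 * b * q^2] (q^4) 3) = prefactor q a b y"
      unfolding pars unfolding y prefactor_def by (simp add: three four)
    show ?thesis
      unfolding pre G' n1 unfolding pars unfolding y
      unfolding n G_eq_sum_summand[OF \<open>q \<noteq> 0\<close> y] sum_summand[OF y nz(1-3) nz'(2-4)]
        boundary_eq_core[OF nz'(1) nz(4), of a b, symmetric]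
      by (simp add: mult_ac del: of_nat_Suc sum.lessThan_Suc)
  qed
qed

end
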